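(* Let $A\in\mathbb{R}^{m\times n}$, $b\in\mathbb{R}^m$ and $\ell,u\in\mathbb{R}^n$ with $\ell\le0\le u$, and consider the ResQPASS iteration described in the context. Let $k_0>0$ be an iteration such that $-\lambda_{k'}+\mu_{k'}\in\mathrm{span}([V_{k_0},A^TAV_{k_0-1}])$ for all iterations $k'\ge k_0$. Let $k>k_0$, $l=k-k_0+1$, $W_{k_0,l}=[v_{k_0},\ldots,v_k]\in\mathbb{R}^{n\times l}$, let $T_{l,l}=W_{k_0,l}^TA^TAW_{k_0,l}$ be the corresponding tridiagonal matrix, and let $P_l(t)$ be the polynomial of order $l$ with $P_l(0)=1$ such that $W_{k_0,l}^Tr_k=P_l(T_{l,l})e_1=0$, where $e_1$ is the first unit vector of $\mathbb{R}^l$. Then $P_l(t)$ has zeros at the Ritz values $\theta_j^{(l)}$, $j=1,\ldots,l$, i.e. at the eigenvalues of $T_{l,l}$.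
   Context: ResQPASS iteration: inequalities between vectors are componentwise. Start with $x_0=0$, $\lambda_0=\mu_0=0$, $r_0=-A^Tb$. For $k\ge1$ let $V_k\in\mathbb{R}^{n\times k}$ be the matrix with columns $v_j=r_{j-1}/\|r_{j-1}\|_2$, $j=1,\dots,k$ (iterations are considered only as long as the residuals $r_0,\dots,r_{k-1}$ are nonzero, so that $V_k$ is defined; $V_0$ is the empty matrix). Let $x_k=V_ky_k$ where $y_k\in\mathbb{R}^k$ solves $\min_{y}\frac12\|AV_ky-b\|_2^2$ s.t. $\ell\le V_ky\le u$, and let $\lambda_k,\mu_k\in\mathbb{R}^n$ be associated Lagrange multipliers of the lower and upper bounds, i.e. the projected KKT conditions hold: $V_k^TA^T(AV_ky_k-b)-V_k^T\lambda_k+V_k^T\mu_k=0$; $(\lambda_k)_i([V_ky_k]_i-\ell_i)=0$ and $(\mu_k)_i(u_i-[V_ky_k]_i)=0$ for all $i$; $\ell\le V_ky_k\le u$; $\lambda_k,\mu_k\ge0$. Then set $r_k=A^T(Ax_k-b)-\lambda_k+\mu_k$. For a block matrix, $\mathrm{span}([X,Y])$ denotes the span of all columns of $X$ and $Y$.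
   Formalization: "The polynomial" P_l is taken to be the unique polynomial of order l with P_l(0)=1 and W^T r_k = P_l(T)e_1 = 0; uniqueness is assumed, since otherwise the claim can fail (e.g. a run with T=diag(2,3), where P(t)=(1-t/2)(1-t) qualifies but P(3) is not 0). *)

theory Defs
  imports "Jordan_Normal_Form.Char_Poly" "Jordan_Normal_Form.VS_Connect" Complex_Main
begin

definition norm2 :: "real vec \<Rightarrow> real" where
  "norm2 v = sqrt (v \<bullet> v)"

text \<open>The residuals are indexed from 0 and the basis vectors from 1.
  Only used for \<^term>\<open>j\<close> with \<open>1 \<le> j\<close> and a nonzero residual \<open>r (j - 1)\<close>.\<close>

definition basis_vec :: "(nat \<Rightarrow> real vec) \<Rightarrow> nat \<Rightarrow> real vec" where
  "basis_vec r j = (1 / norm2 (r (j - 1))) \<cdot>\<^sub>v r (j - 1)"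

text \<open>The matrix with columns \<open>v\<^sub>i, \<dots>, v\<^sub>j\<close>; it has no columns if \<open>j < i\<close>.\<close>

definition basis_block :: "nat \<Rightarrow> (nat \<Rightarrow> real vec) \<Rightarrow> nat \<Rightarrow> nat \<Rightarrow> real mat" where
  "basis_block n r i j = mat_of_cols n (map (basis_vec r) [i..<Suc j])"

definition basis_mat :: "nat \<Rightarrow> (nat \<Rightarrow> real vec) \<Rightarrow> nat \<Rightarrow> real mat" where
  "basis_mat n r k = basis_block n r 1 k"

text \<open>\<open>k\<close> is an iteration of the method: the residuals needed to form the first \<open>k\<close>
  basis vectors do not vanish.\<close>

definition is_iteration :: "nat \<Rightarrow> (nat \<Rightarrow> real vec) \<Rightarrow> nat \<Rightarrow> bool" where
  "is_iteration n r k \<longleftrightarrow> (\<forall>j<k. r j \<noteq> 0\<^sub>v n)"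

definition feasible_coeff :: "real vec \<Rightarrow> real vec \<Rightarrow> real mat \<Rightarrow> real vec \<Rightarrow> bool" where
  "feasible_coeff lb ub V y \<longleftrightarrow>
     y \<in> carrier_vec (dim_col V) \<and> lb \<le> V *\<^sub>v y \<and> V *\<^sub>v y \<le> ub"

definition projected_objective :: "real mat \<Rightarrow> real vec \<Rightarrow> real mat \<Rightarrow> real vec \<Rightarrow> real" where
  "projected_objective A b V y = 1 / 2 * (norm2 (A *\<^sub>v (V *\<^sub>v y) - b))\<^sup>2"

definition solves_projected ::
  "real mat \<Rightarrow> real vec \<Rightarrow> real vec \<Rightarrow> real vec \<Rightarrow> real mat \<Rightarrow> real vec \<Rightarrow> bool" where
  "solves_projected A b lb ub V y \<longleftrightarrow>
     feasible_coeff lb ub V y \<and>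
     (\<forall>z. feasible_coeff lb ub V z \<longrightarrow>
        projected_objective A b V y \<le> projected_objective A b V z)"

definition projected_KKT ::
  "real mat \<Rightarrow> real vec \<Rightarrow> real vec \<Rightarrow> real vec \<Rightarrow> real mat \<Rightarrow>
   real vec \<Rightarrow> real vec \<Rightarrow> real vec \<Rightarrow> bool" where
  "projected_KKT A b lb ub V y lam mu \<longleftrightarrow>
     lam \<in> carrier_vec (dim_row V) \<and> mu \<in> carrier_vec (dim_row V) \<and>
     V\<^sup>T *\<^sub>v (A\<^sup>T *\<^sub>v (A *\<^sub>v (V *\<^sub>v y) - b)) - V\<^sup>T *\<^sub>v lam + V\<^sup>T *\<^sub>v mu = 0\<^sub>v (dim_col V) \<and>
     (\<forall>i<dim_row V. lam $ i * ((V *\<^sub>v y) $ i - lb $ i) = 0) \<and>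
     (\<forall>i<dim_row V. mu $ i * (ub $ i - (V *\<^sub>v y) $ i) = 0) \<and>
     feasible_coeff lb ub V y \<and>
     0\<^sub>v (dim_row V) \<le> lam \<and> 0\<^sub>v (dim_row V) \<le> mu"

text \<open>The sequences are total functions on \<^typ>\<open>nat\<close>; their values beyond the last
  iteration are unconstrained.\<close>

definition resqpass ::
  "real mat \<Rightarrow> real vec \<Rightarrow> real vec \<Rightarrow> real vec \<Rightarrow> (nat \<Rightarrow> real vec) \<Rightarrow> (nat \<Rightarrow> real vec) \<Rightarrow>
   (nat \<Rightarrow> real vec) \<Rightarrow> (nat \<Rightarrow> real vec) \<Rightarrow> (nat \<Rightarrow> real vec) \<Rightarrow> bool" where
  "resqpass A b lb ub y x lam mu r \<longleftrightarrow>
     (let n = dim_col A in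
       x 0 = 0\<^sub>v n \<and> lam 0 = 0\<^sub>v n \<and> mu 0 = 0\<^sub>v n \<and> r 0 = - (A\<^sup>T *\<^sub>v b) \<and>
       (\<forall>k\<ge>1. is_iteration n r k \<longrightarrow>
          solves_projected A b lb ub (basis_mat n r k) (y k) \<and>
          x k = basis_mat n r k *\<^sub>v y k \<and>
          projected_KKT A b lb ub (basis_mat n r k) (y k) (lam k) (mu k) \<and>
          r k = A\<^sup>T *\<^sub>v (A *\<^sub>v x k - b) - lam k + mu k))"

text \<open>The span of all columns of the block matrix \<open>[X, Y]\<close>.\<close>

definition block_span :: "nat \<Rightarrow> real mat \<Rightarrow> real mat \<Rightarrow> real vec set" where
  "block_span n X Y = vec_space.col_space n (mat_of_cols n (cols X @ cols Y))"

definition poly_mat :: "'a :: comm_ring_1 poly \<Rightarrow> 'a mat \<Rightarrow> 'a mat" where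
  "poly_mat p M = mat (dim_row M) (dim_row M)
     (\<lambda>(i, j). \<Sum>d\<le>degree p. coeff p d * (M ^\<^sub>m d) $$ (i, j))"

text \<open>\<open>P\<close> is a polynomial of order \<open>l\<close> with \<open>P(0) = 1\<close> and \<open>w = P(T) e\<^sub>1 = 0\<close>,
  where \<open>w\<close> is the projected residual.  The unit vectors of the library are indexed from 0.\<close>

definition residual_poly :: "nat \<Rightarrow> real mat \<Rightarrow> real vec \<Rightarrow> real poly \<Rightarrow> bool" where
  "residual_poly l T w P \<longleftrightarrow>
     degree P = l \<and> poly P 0 = 1 \<and>
     w = poly_mat P T *\<^sub>v unit_vec l 0 \<and> poly_mat P T *\<^sub>v unit_vec l 0 = 0\<^sub>v l"

text \<open>``The polynomial'' with these properties: a definite description, so uniqueness is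
  part of it.  It is not automatic.  If the Krylov space of \<open>T\<close> and \<open>e\<^sub>1\<close> is a proper
  subspace, then there are either no such polynomials or several, and a choice of one of
  several need not vanish at all eigenvalues of \<open>T\<close> (take \<open>T = diag(2, 3)\<close> and
  \<open>P(t) = (1 - t/2)(1 - t)\<close>).\<close>

definition the_residual_poly :: "nat \<Rightarrow> real mat \<Rightarrow> real vec \<Rightarrow> real poly \<Rightarrow> bool" where
  "the_residual_poly l T w P \<longleftrightarrow>
     residual_poly l T w P \<and> (\<forall>Q. residual_poly l T w Q \<longrightarrow> Q = P)"

end

theory Submission
  imports Defs
begin

text \<open>The reason is the uniqueness of \<open>P\<close>: it forces every left eigenvector of \<open>T\<close> to have a
  nonzero first entry.

  Let \<open>\<theta>\<close> be an eigenvalue of the \<open>l \<times> l\<close> matrix \<open>T\<close>, and let \<open>w \<noteq> 0\<close> be a left eigenvector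
  for it. Then \<open>w\<^sup>T p(T) u = p(\<theta>) w\<^sup>T u\<close> for every polynomial \<open>p\<close>
  (\<open>left_eigenvector_poly_mat\<close>), so \<open>P(T) e\<^sub>1 = 0\<close> gives \<open>P(\<theta>) w\<^sub>1 = 0\<close>, and it remains to
  exclude \<open>w\<^sub>1 = 0\<close>. If \<open>w\<^sub>1 = 0\<close>, then \<open>w\<close> is orthogonal to the whole Krylov sequence, in
  particular to the \<open>l\<close> vectors \<open>T e\<^sub>1, \<dots>, T\<^sup>l e\<^sub>1\<close>, which are therefore linearly dependent. The
  dependence is a nonzero polynomial \<open>R\<close> of degree at most \<open>l\<close> with \<open>R(0) = 0\<close> and
  \<open>R(T) e\<^sub>1 = 0\<close> (\<open>krylov_dependence\<close>). Both \<open>P + R\<close> and \<open>P - R\<close> differ from \<open>P\<close>, take the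
  value 1 at 0 and annihilate \<open>e\<^sub>1\<close>. At least one of them has degree exactly \<open>l\<close>, which
  contradicts the uniqueness of \<open>P\<close>.\<close>

text \<open>Polynomials in a matrix are accessed through the scalars \<open>w\<^sup>T p(M) u\<close>. The free
  bound \<open>D\<close> on the degree makes these scalars visibly linear in \<open>p\<close>: polynomials of
  different degrees are summed over the same range.\<close>

lemma scalar_prod_poly_mat:
  fixes M :: "'a :: comm_ring_1 mat"
  assumes M: "M \<in> carrier_mat n n" and w: "w \<in> carrier_vec n" and u: "u \<in> carrier_vec n"
    and D: "degree p \<le> D"
  shows "w \<bullet> (poly_mat p M *\<^sub>v u) = (\<Sum>d\<le>D. coeff p d * (w \<bullet> (M ^\<^sub>m d *\<^sub>v u)))"
proof -
  have pow: "dim_row (M ^\<^sub>m d) = n" "dim_col (M ^\<^sub>m d) = n" for d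
    using pow_carrier_mat[OF M, of d] by auto
  have "w \<bullet> (poly_mat p M *\<^sub>v u)
      = (\<Sum>i<n. w $ i * (\<Sum>j<n. (\<Sum>d\<le>degree p. coeff p d * (M ^\<^sub>m d) $$ (i, j)) * u $ j))"
    using M u
    by (auto simp: scalar_prod_def poly_mat_def lessThan_atLeast0 intro!: sum.cong)
  also have "\<dots> = (\<Sum>i<n. \<Sum>j<n. \<Sum>d\<le>degree p. coeff p d * (w $ i * ((M ^\<^sub>m d) $$ (i, j) * u $ j)))"
    by (simp add: sum_distrib_left sum_distrib_right mult_ac)
  also have "\<dots> = (\<Sum>i<n. \<Sum>d\<le>degree p. \<Sum>j<n. coeff p d * (w $ i * ((M ^\<^sub>m d) $$ (i, j) * u $ j)))"
    by (intro sum.cong refl sum.swap)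
  also have "\<dots> = (\<Sum>d\<le>degree p. \<Sum>i<n. \<Sum>j<n. coeff p d * (w $ i * ((M ^\<^sub>m d) $$ (i, j) * u $ j)))"
    by (rule sum.swap)
  also have "\<dots> = (\<Sum>d\<le>degree p. coeff p d * (w \<bullet> (M ^\<^sub>m d *\<^sub>v u)))"
    using w u
    by (auto simp: scalar_prod_def pow carrier_matD[OF M] sum_distrib_left lessThan_atLeast0
        intro!: sum.cong)
  also have "\<dots> = (\<Sum>d\<le>D. coeff p d * (w \<bullet> (M ^\<^sub>m d *\<^sub>v u)))"
    using D by (intro sum.mono_neutral_left) (auto simp: coeff_eq_0)
  finally show ?thesis .
qed

lemma poly_mat_mult_vec_index:
  fixes M :: "'a :: comm_ring_1 mat"
  assumes M: "M \<in> carrier_mat n n" and u: "u \<in> carrier_vec n"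
    and D: "degree p \<le> D" and i: "i < n"
  shows "(poly_mat p M *\<^sub>v u) $ i = (\<Sum>d\<le>D. coeff p d * (M ^\<^sub>m d *\<^sub>v u) $ i)"
proof -
  have "poly_mat p M *\<^sub>v u \<in> carrier_vec n"
    using M by (intro carrier_vecI) (simp add: poly_mat_def)
  moreover have "M ^\<^sub>m d *\<^sub>v u \<in> carrier_vec n" for d
    using pow_carrier_mat[OF M, of d] u by simp
  ultimately show ?thesis
    using scalar_prod_poly_mat[OF M unit_vec_carrier u D, of i] i
    by (simp add: scalar_prod_left_unit)
qed

lemma poly_mat_add_mult_vec:
  fixes M :: "'a :: comm_ring_1 mat"
  assumes M: "M \<in> carrier_mat n n" and u: "u \<in> carrier_vec n"
  shows "poly_mat (p + q) M *\<^sub>v u = poly_mat p M *\<^sub>v u + poly_mat q M *\<^sub>v u"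
proof (rule eq_vecI)
  define D where "D = max (degree p) (degree q)"
  have D: "degree p \<le> D" "degree q \<le> D" "degree (p + q) \<le> D"
    using degree_add_le_max[of p q] by (auto simp: D_def)
  fix i assume "i < dim_vec (poly_mat p M *\<^sub>v u + poly_mat q M *\<^sub>v u)"
  then have i: "i < n" using M by (simp add: poly_mat_def)
  then have "(poly_mat p M *\<^sub>v u + poly_mat q M *\<^sub>v u) $ i
      = (poly_mat p M *\<^sub>v u) $ i + (poly_mat q M *\<^sub>v u) $ i"
    using M by (intro index_add_vec) (simp add: poly_mat_def)
  then show "(poly_mat (p + q) M *\<^sub>v u) $ i = (poly_mat p M *\<^sub>v u + poly_mat q M *\<^sub>v u) $ i"
    by (simp only: poly_mat_mult_vec_index[OF M u _ i, of _ D] D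
        coeff_add distrib_right sum.distrib)
qed (use M in \<open>simp add: poly_mat_def\<close>)

lemma poly_mat_uminus_mult_vec:
  fixes M :: "'a :: comm_ring_1 mat"
  assumes M: "M \<in> carrier_mat n n" and u: "u \<in> carrier_vec n"
  shows "poly_mat (- p) M *\<^sub>v u = - (poly_mat p M *\<^sub>v u)"
proof (rule eq_vecI)
  fix i assume "i < dim_vec (- (poly_mat p M *\<^sub>v u))"
  then have i: "i < n" "i < dim_vec (poly_mat p M *\<^sub>v u)"
    using M by (simp_all add: poly_mat_def)
  show "(poly_mat (- p) M *\<^sub>v u) $ i = (- (poly_mat p M *\<^sub>v u)) $ i"
    unfolding index_uminus_vec(1)[OF i(2)]
    by (simp only: poly_mat_mult_vec_index[OF M u _ i(1), of _ "degree p"]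
        degree_minus order_refl coeff_minus mult_minus_left sum_negf)
qed (use M in \<open>simp add: poly_mat_def\<close>)

lemma left_eigenvector_pow_mat:
  fixes M :: "'a :: comm_ring_1 mat"
  assumes M: "M \<in> carrier_mat n n" and w: "w \<in> carrier_vec n"
    and eig: "M\<^sup>T *\<^sub>v w = \<theta> \<cdot>\<^sub>v w" and u: "u \<in> carrier_vec n"
  shows "w \<bullet> (M ^\<^sub>m d *\<^sub>v u) = \<theta> ^ d * (w \<bullet> u)"
  using u
proof (induction d arbitrary: u)
  case 0
  then show ?case using M by simp
next
  case (Suc d)
  have Mu: "M *\<^sub>v u \<in> carrier_vec n" using M Suc.prems by simp
  have "w \<bullet> (M ^\<^sub>m Suc d *\<^sub>v u) = w \<bullet> (M ^\<^sub>m d *\<^sub>v (M *\<^sub>v u))"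
    using assoc_mult_mat_vec[OF pow_carrier_mat[OF M] M Suc.prems] by simp
  also have "\<dots> = \<theta> ^ d * (w \<bullet> (M *\<^sub>v u))" using Suc.IH[OF Mu] .
  also have "w \<bullet> (M *\<^sub>v u) = (M\<^sup>T *\<^sub>v w) \<bullet> u"
    using transpose_vec_mult_scalar[OF M Suc.prems w] by simp
  also have "\<dots> = \<theta> * (w \<bullet> u)"
    using w Suc.prems by (simp add: eig)
  finally show ?case by (simp add: mult_ac)
qed

lemma left_eigenvector_poly_mat:
  fixes M :: "'a :: comm_ring_1 mat"
  assumes M: "M \<in> carrier_mat n n" and w: "w \<in> carrier_vec n"
    and eig: "M\<^sup>T *\<^sub>v w = \<theta> \<cdot>\<^sub>v w" and u: "u \<in> carrier_vec n"
  shows "w \<bullet> (poly_mat p M *\<^sub>v u) = poly p \<theta> * (w \<bullet> u)"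
  by (simp add: scalar_prod_poly_mat[OF M w u order_refl] left_eigenvector_pow_mat[OF assms]
      poly_altdef sum_distrib_right mult.assoc)

text \<open>A square matrix and its transpose have the same characteristic polynomial, so every
  eigenvalue has a left eigenvector too.\<close>

lemma eigenvalue_left_eigenvector:
  fixes M :: "'a :: field mat"
  assumes M: "M \<in> carrier_mat n n" and "eigenvalue M \<theta>"
  obtains w where "w \<in> carrier_vec n" "w \<noteq> 0\<^sub>v n" "M\<^sup>T *\<^sub>v w = \<theta> \<cdot>\<^sub>v w"
proof -
  have "eigenvalue M\<^sup>T \<theta>"
    using assms eigenvalue_root_char_poly[OF M]
      eigenvalue_root_char_poly[of "M\<^sup>T" n] char_poly_transpose_mat[OF M] by simp
  then show ?thesis
    using that M by (auto simp: eigenvalue_def eigenvector_def)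
qed

text \<open>The matrix with columns \<open>M u, \<dots>, M\<^sup>n u\<close> is singular because its transpose kills \<open>w\<close>.
  Starting at \<open>M u\<close> rather than at \<open>u\<close> makes the resulting relation vanish at 0.\<close>

lemma krylov_dependence:
  fixes M :: "'a :: field mat"
  assumes M: "M \<in> carrier_mat n n" and u: "u \<in> carrier_vec n"
    and w: "w \<in> carrier_vec n" "w \<noteq> 0\<^sub>v n"
    and orth: "\<And>d. w \<bullet> (M ^\<^sub>m d *\<^sub>v u) = 0"
  obtains R where "R \<noteq> 0" "degree R \<le> n" "poly R 0 = 0" "poly_mat R M *\<^sub>v u = 0\<^sub>v n"
proof -
  define K where "K = mat_of_cols n (map (\<lambda>i. M ^\<^sub>m Suc i *\<^sub>v u) [0..<n])"
  have K: "K \<in> carrier_mat n n" by (simp add: K_def mat_of_cols_def)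
  have carr: "M ^\<^sub>m d *\<^sub>v u \<in> carrier_vec n" for d
    using pow_carrier_mat[OF M, of d] u by simp
  have "K\<^sup>T *\<^sub>v w = 0\<^sub>v n"
  proof (rule eq_vecI)
    fix i assume "i < dim_vec (0\<^sub>v n :: 'a vec)"
    then have i: "i < n" by simp
    then have "col K i = M ^\<^sub>m Suc i *\<^sub>v u"
      unfolding K_def using carr[of "Suc i"] by (subst col_mat_of_cols) simp_all
    then have "(K\<^sup>T *\<^sub>v w) $ i = (M ^\<^sub>m Suc i *\<^sub>v u) \<bullet> w"
      using i K by simp
    also have "\<dots> = 0"
      using orth comm_scalar_prod[OF carr w(1)] by metis
    finally show "(K\<^sup>T *\<^sub>v w) $ i = 0\<^sub>v n $ i" using i by simp
  qed (use K in simp)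
  then have "det K\<^sup>T = 0"
    using w K by (subst det_0_iff_vec_prod_zero[of _ n]) auto
  then have "det K = 0" using det_transpose[OF K] by simp
  then obtain v where v: "v \<in> carrier_vec n" "v \<noteq> 0\<^sub>v n" "K *\<^sub>v v = 0\<^sub>v n"
    using det_0_iff_vec_prod_zero[OF K] by auto
  define R where "R = pCons 0 (\<Sum>i<n. monom (v $ i) i)"
  have coeff_R: "coeff R (Suc i) = v $ i" if "i < n" for i
    using that by (simp add: R_def coeff_sum)
  have "\<exists>i<n. v $ i \<noteq> 0"
    using v(1,2) by (auto intro: eq_vecI)
  then have "R \<noteq> 0"
    using coeff_R by force
  moreover have deg: "degree R \<le> n"
    by (rule degree_le) (auto simp: R_def coeff_sum coeff_pCons split: nat.split)
  moreover have "poly R 0 = 0" by (simp add: R_def)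
  moreover have "poly_mat R M *\<^sub>v u = 0\<^sub>v n"
  proof (rule eq_vecI)
    fix i assume "i < dim_vec (0\<^sub>v n :: 'a vec)"
    then have i: "i < n" by simp
    have "(poly_mat R M *\<^sub>v u) $ i = (\<Sum>d<Suc n. coeff R d * (M ^\<^sub>m d *\<^sub>v u) $ i)"
      by (simp only: poly_mat_mult_vec_index[OF M u deg i] lessThan_Suc_atMost)
    also have "\<dots> = (\<Sum>j<n. v $ j * (M ^\<^sub>m Suc j *\<^sub>v u) $ i)"
      by (simp only: sum.lessThan_Suc_shift) (simp add: coeff_R, simp add: R_def)
    also have "\<dots> = (K *\<^sub>v v) $ i"
    proof -
      have "K $$ (i, j) = (M ^\<^sub>m Suc j *\<^sub>v u) $ i" if "j < n" for j
        using i that by (simp add: K_def mat_of_cols_index del: pow_mat.simps)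
      then show ?thesis
        using i K v(1)
        by (auto simp: scalar_prod_def mult.commute lessThan_atLeast0
            simp del: pow_mat.simps intro!: sum.cong)
    qed
    finally show "(poly_mat R M *\<^sub>v u) $ i = 0\<^sub>v n $ i" by (simp add: v(3))
  qed (use M in \<open>simp add: poly_mat_def\<close>)
  ultimately show ?thesis using that by blast
qed

text \<open>If the leading coefficients cancelled in \<open>P + R\<close> and also in \<open>P - R\<close>, then that of
  \<open>P\<close> would be 0 in characteristic 0.\<close>

lemma degree_add_or_diff_eq:
  fixes P R :: "'a :: field_char_0 poly"
  assumes "P \<noteq> 0" "degree R \<le> degree P"
  shows "degree (P + R) = degree P \<or> degree (P - R) = degree P"
proof -
  have le: "degree (P + R) \<le> degree P" "degree (P - R) \<le> degree P"
    using assms(2) by (auto intro: degree_add_le degree_diff_le)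
  have "coeff (P + R) (degree P) + coeff (P - R) (degree P) = 2 * lead_coeff P"
    by simp
  then have "coeff (P + R) (degree P) \<noteq> 0 \<or> coeff (P - R) (degree P) \<noteq> 0"
    using assms(1) by (metis add_0 mult_eq_0_iff leading_coeff_0_iff zero_neq_numeral)
  then show ?thesis
    using le by (meson le_antisym le_degree)
qed

lemma the_residual_poly_vanishes_at_eigenvalues:
  assumes T: "T \<in> carrier_mat l l" and l: "0 < l"
    and P: "the_residual_poly l T z P" and \<theta>: "eigenvalue T \<theta>"
  shows "poly P \<theta> = 0"
proof -
  let ?e = "unit_vec l 0 :: real vec"
  have e: "?e \<in> carrier_vec l" by simp
  have deg: "degree P = l" and P0: "poly P 0 = 1" and z: "z = poly_mat P T *\<^sub>v ?e"
    and Pe: "poly_mat P T *\<^sub>v ?e = 0\<^sub>v l"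
    using P unfolding the_residual_poly_def residual_poly_def by blast+
  have uniq: "Q = P" if "residual_poly l T z Q" for Q
    using P that unfolding the_residual_poly_def by blast
  obtain w where w: "w \<in> carrier_vec l" "w \<noteq> 0\<^sub>v l" and eig: "T\<^sup>T *\<^sub>v w = \<theta> \<cdot>\<^sub>v w"
    using eigenvalue_left_eigenvector[OF T \<theta>] .
  have "w \<bullet> ?e \<noteq> 0"
  proof
    assume "w \<bullet> ?e = 0"
    then have "w \<bullet> (T ^\<^sub>m d *\<^sub>v ?e) = 0" for d
      using left_eigenvector_pow_mat[OF T w(1) eig e] by simp
    then obtain R where R: "R \<noteq> 0" "degree R \<le> l" "poly R 0 = 0"
      and Re: "poly_mat R T *\<^sub>v ?e = 0\<^sub>v l"
      using krylov_dependence[OF T e w] by blast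
    have "poly_mat (- R) T *\<^sub>v ?e = 0\<^sub>v l"
      using poly_mat_uminus_mult_vec[OF T e, of R] Re by simp
    then have "poly_mat (P + R) T *\<^sub>v ?e = 0\<^sub>v l" "poly_mat (P - R) T *\<^sub>v ?e = 0\<^sub>v l"
      using poly_mat_add_mult_vec[OF T e, of P R] poly_mat_add_mult_vec[OF T e, of P "- R"]
      by (simp_all add: Pe Re)
    moreover have "degree (P + R) = l \<or> degree (P - R) = l"
      using degree_add_or_diff_eq[of P R] P0 R(2) deg by (cases "P = 0") auto
    ultimately have "residual_poly l T z (P + R) \<or> residual_poly l T z (P - R)"
      using P0 R(3) Pe z by (auto simp: residual_poly_def)
    then have "P + R = P \<or> P - R = P" using uniq by blast
    then show False using R(1) by simp
  qed
  moreover have "poly P \<theta> * (w \<bullet> ?e) = 0"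
    using left_eigenvector_poly_mat[OF T w(1) eig e, of P] w(1) by (simp add: Pe)
  ultimately show ?thesis by simp
qed

theorem lemma2p10:
  fixes A W T :: "real mat" and b lb ub :: "real vec"
    and y x lam mu r :: "nat \<Rightarrow> real vec"
    and m n k0 k l :: nat and P :: "real poly"
  assumes A: "A \<in> carrier_mat m n" and b: "b \<in> carrier_vec m"
    and lb: "lb \<in> carrier_vec n" and ub: "ub \<in> carrier_vec n"
    and bounds: "lb \<le> 0\<^sub>v n" "0\<^sub>v n \<le> ub"
    and run: "resqpass A b lb ub y x lam mu r"
    and k0: "k0 > 0" "is_iteration n r k0"
    and span: "\<And>k'. k' \<ge> k0 \<Longrightarrow> is_iteration n r k' \<Longrightarrow>
       - lam k' + mu k' \<in>
         block_span n (basis_mat n r k0) (A\<^sup>T * A * basis_mat n r (k0 - 1))"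
    and k: "k > k0" "is_iteration n r k"
    and l: "l = k - k0 + 1"
    and W: "W = basis_block n r k0 k"
    and T: "T = W\<^sup>T * A\<^sup>T * A * W"
    and P: "the_residual_poly l T (W\<^sup>T *\<^sub>v r k) P"
  shows "\<forall>\<theta>. eigenvalue T \<theta> \<longrightarrow> poly P \<theta> = 0"
proof -
  have "W \<in> carrier_mat n l"
    using k(1) by (simp add: W l basis_block_def mat_of_cols_def Suc_diff_le)
  then have "T \<in> carrier_mat l l"
    by (intro carrier_matI) (auto simp: T)
  moreover have "0 < l" by (simp add: l)
  ultimately show ?thesis
    using the_residual_poly_vanishes_at_eigenvalues P by blast
qed

end
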